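(* Let $q$ be an odd prime power and $n$ a prime with $(q^n-1)/2$ even. Let $\beta\in\mathbb{F}_q^*$, let $m$ be an even divisor of $q^n-1$, let $Q=\frac{q^n-1}{q-1}$, and let $m_Q$ be the product of those primes dividing $m$ which divide $Q$. Then $$\mathcal{N}_\beta(m)\ \ge\ \theta(m)\,q^{\frac{n-1}{2}}\left\{q^{\frac{n-1}{2}}-4W(m)+2W(m_Q)+1\right\}.$$ Consequently $\mathcal{N}_\beta(q^n-1)>0$ whenever $q^{\frac{n-1}{2}}>4W(q^n-1)-2W(Q)-1$.
   Context: For a divisor $m$ of $q^n-1$, an element $\xi\in\mathbb{F}_{q^n}^*$ is called $m$-free if $\xi=\zeta^d$ with $d\mid m$ and $\zeta\in\mathbb{F}_{q^n}^*$ implies $d=1$ (the $(q^n-1)$-free elements are exactly the primitive elements). $\mathcal{N}_\beta(m)$ denotes the number of $m$-free elements $\xi\in\mathbb{F}_{q^n}^*$ such that $\mathrm{Tr}(\xi^2)=\beta$, where $\mathrm{Tr}:\mathbb{F}_{q^n}\to\mathbb{F}_q$ is the trace map. $\theta(m)=\phi(m)/m$ with $\phi$ Euler's function, and $W(m)=2^{\nu(m)}$ where $\nu(m)$ is the number of distinct prime divisors of $m$ (so $W(1)=1$). *)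

theory Defs
  imports Complex_Main "HOL-Library.Cardinality" "HOL-Number_Theory.Number_Theory"
begin

definition is_subfield :: "'a::field set \<Rightarrow> bool" where
  "is_subfield K \<longleftrightarrow> 0 \<in> K \<and> 1 \<in> K \<and>
     (\<forall>x\<in>K. \<forall>y\<in>K. x + y \<in> K) \<and> (\<forall>x\<in>K. - x \<in> K) \<and>
     (\<forall>x\<in>K. \<forall>y\<in>K. x * y \<in> K) \<and> (\<forall>x\<in>K. inverse x \<in> K)"

text \<open>The trace from the field with \<open>q ^ n\<close> elements down to its subfield with \<open>q\<close> elements,
  as the sum of the conjugates; its values are elements of the subfield, viewed in the large
  field.\<close>

definition ff_trace :: "nat \<Rightarrow> nat \<Rightarrow> 'a::field \<Rightarrow> 'a" where
  "ff_trace q n x = (\<Sum>i<n. x ^ (q ^ i))"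

definition m_free :: "nat \<Rightarrow> 'a::field \<Rightarrow> bool" where
  "m_free m \<xi> \<longleftrightarrow> \<xi> \<noteq> 0 \<and> (\<forall>d \<zeta>. d dvd m \<and> \<zeta> \<noteq> 0 \<and> \<xi> = \<zeta> ^ d \<longrightarrow> d = 1)"

definition N_free :: "nat \<Rightarrow> nat \<Rightarrow> 'a::{field,finite} \<Rightarrow> nat \<Rightarrow> nat" where
  "N_free q n \<beta> m = card {\<xi>. m_free m \<xi> \<and> ff_trace q n (\<xi>\<^sup>2) = \<beta>}"

definition theta :: "nat \<Rightarrow> real" where
  "theta m = real (totient m) / real m"

definition W :: "nat \<Rightarrow> nat" where
  "W m = 2 ^ card (prime_factors m)"

definition prime_part :: "nat \<Rightarrow> nat \<Rightarrow> nat" where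
  "prime_part m Q = (\<Prod>p\<in>{p \<in> prime_factors m. p dvd Q}. p)"

end

theory Submission
  imports Defs "HOL-Computational_Algebra.Polynomial"
begin

text \<open>
  Let \<open>N = q ^ n - 1\<close> and \<open>B = q powr ((n - 1) / 2)\<close>. The stronger bound
  \<open>\<theta>(m) B (B - 2 W(m) + 1)\<close> is proved; it implies the stated one because \<open>W(m\<^sub>Q) \<le> W(m)\<close>.

  The indicator of the \<open>m\<close>-free elements is \<open>\<theta>(m)\<close> times a product over the primes \<open>p\<close> dividing \<open>m\<close>
  of factors \<open>1 - a\<^sub>p\<close>, where \<open>a\<^sub>p\<close> is an average of multiplicative characters. Expanding it leaves
  \<open>W(m)\<close> averages of sums \<open>E(\<chi>) = \<Sum>x\<noteq>0. \<chi>(x) ([Tr(x\<^sup>2) = \<beta>] - 1/q)\<close>. Detecting the trace condition by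
  additive characters of the subfield, \<open>E(\<chi>)\<close> vanishes if \<open>\<chi>(-1) = -1\<close> and otherwise, writing
  \<open>\<chi> = \<eta>\<^sup>2\<close> and \<open>\<lambda>\<close> for the quadratic character, it is a sum of two products of a Gauss sum over the
  large field with one over the subfield, for \<open>\<eta>\<close> and for \<open>\<eta>\<lambda>\<close>. Each product contributes at most \<open>B\<close>,
  and for trivial \<open>\<chi>\<close> the first one is exactly \<open>1/q\<close>, which completes \<open>N/q\<close> to the main term \<open>B\<^sup>2\<close>.
\<close>

section \<open>Subfields and traces\<close>

lemma is_subfield_UNIV: "is_subfield (UNIV :: 'a::field set)"
  by (simp add: is_subfield_def)

lemma is_subfield_diff: "is_subfield K \<Longrightarrow> x \<in> K \<Longrightarrow> y \<in> K \<Longrightarrow> x - y \<in> K"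
  unfolding is_subfield_def by (metis diff_conv_add_uminus)

lemma is_subfield_divide: "is_subfield K \<Longrightarrow> x \<in> K \<Longrightarrow> y \<in> K \<Longrightarrow> x / y \<in> K"
  unfolding is_subfield_def by (metis divide_inverse)

text \<open>Multiplication by a nonzero \<open>x\<close> permutes \<open>K - {0}\<close>; comparing
  the product of all nonzero elements before and after gives
  \<open>x ^ (card K - 1) = 1\<close>.\<close>

lemma subfield_power_card:
  fixes K :: "'a::{field,finite} set"
  assumes K: "is_subfield K" and x: "x \<in> K"
  shows "x ^ card K = x"
proof (cases "x = 0")
  case True
  then show ?thesis using x by (simp add: card_gt_0_iff) auto
next
  case False
  have z: "0 \<in> K" using K by (simp add: is_subfield_def)
  have "(\<Prod>y\<in>K-{0}. x * y) = (\<Prod>y\<in>K-{0}. y)"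
    by (rule prod.reindex_bij_witness[of _ "\<lambda>y. y / x" "\<lambda>y. x * y"])
      (use False K x in \<open>auto intro: is_subfield_divide simp: is_subfield_def\<close>)
  then have "x ^ (card K - 1) * \<Prod>(K-{0}) = \<Prod>(K-{0})"
    using z by (simp add: prod.distrib card_Diff_singleton)
  then have "x ^ (card K - 1) = 1"
    by (auto simp: prod_zero_iff)
  moreover have "Suc (card K - 1) = card K"
    using z by (metis card_gt_0_iff empty_iff finite Suc_diff_1)
  ultimately show ?thesis
    by (metis mult.right_neutral power_Suc)
qed

lemma card_power_eq_self_le:
  assumes "k \<ge> 2"
  shows "card {x::'a::field. x ^ k = x} \<le> k"
proof -
  define P :: "'a poly" where "P = Polynomial.monom 1 k - Polynomial.monom 1 1"
  have "Polynomial.coeff P k = 1" using assms by (simp add: P_def)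
  then have P0: "P \<noteq> 0" by auto
  have "Polynomial.degree P \<le> k"
    unfolding P_def using assms
    by (intro degree_diff_le) (auto intro: order.trans[OF degree_monom_le])
  then have "card {x. poly P x = 0} \<le> k"
    using card_poly_roots_bound[OF P0] by linarith
  then show ?thesis by (simp add: P_def poly_monom)
qed

text \<open>\<open>K\<close> already supplies \<open>card K\<close> roots of X^(card K) - X, and
  this polynomial cannot have more.\<close>

lemma subfield_mem_iff_power_card:
  fixes K :: "'a::{field,finite} set"
  assumes K: "is_subfield K"
  shows "x \<in> K \<longleftrightarrow> x ^ card K = x"
proof
  assume "x ^ card K = x"
  have "{0, 1} \<subseteq> K" using K by (auto simp: is_subfield_def)
  then have "card {0, 1 :: 'a} \<le> card K" by (intro card_mono) auto
  then have "card {x::'a. x ^ card K = x} \<le> card K"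
    by (intro card_power_eq_self_le) simp
  then have "K = {x. x ^ card K = x}"
    using subfield_power_card[OF K] by (intro card_seteq) auto
  with \<open>x ^ card K = x\<close> show "x \<in> K" by blast
qed (rule subfield_power_card[OF K])

section \<open>Frobenius and the trace\<close>

lemma prime_CHAR_finite: "prime CHAR('a::{field,finite})"
  using finite_imp_CHAR_pos[where 'a='a] prime_CHAR_semidom[where 'a='a] by auto

text \<open>Exhibits raising to the power \<open>q\<close> as an iterate of the Frobenius map, which
  makes it additive.\<close>

lemma primepow_card_root_eq_CHAR_power:
  assumes "primepow q" "CARD('a::{field,finite}) = q ^ n"
  obtains r where "r > 0" "q = CHAR('a) ^ r"
proof -
  obtain p r where pr: "prime p" "r > 0" "q = p ^ r"
    using assms(1) by (auto simp: primepow_def)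
  have "CHAR('a) dvd p ^ (r * n)"
    using CHAR_dvd_CARD[where 'a='a] assms(2) pr by (simp add: power_mult)
  then have "CHAR('a) dvd p"
    using prime_dvd_power[OF prime_CHAR_finite] by blast
  then have "CHAR('a) = p"
    using primes_dvd_imp_eq[OF prime_CHAR_finite[where 'a='a] \<open>prime p\<close>] by simp
  with pr that show ?thesis by simp
qed

lemma ff_trace_add:
  fixes x y :: "'a::{field,finite}"
  assumes "q = CHAR('a) ^ r"
  shows "ff_trace q n (x + y) = ff_trace q n x + ff_trace q n y"
proof -
  have "(x + y) ^ q ^ i = x ^ q ^ i + y ^ q ^ i" for i
    by (rule freshmans_dream'[OF prime_CHAR_finite, where n = "r * i"])
      (simp add: assms power_mult)
  then show ?thesis by (simp add: ff_trace_def sum.distrib)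
qed

lemma ff_trace_mult:
  fixes x u :: "'a::field"
  assumes "u ^ q = u"
  shows "ff_trace q n (u * x) = u * ff_trace q n x"
proof -
  have "u ^ q ^ i = u" for i
    by (induction i) (simp_all add: power_mult assms)
  then show ?thesis by (simp add: ff_trace_def sum_distrib_left power_mult_distrib)
qed

text \<open>Raising to the power \<open>q\<close> shifts the conjugates by one place, and
  \<open>x ^ q ^ n = x\<close> closes the cycle. Adding \<open>x\<close> to both sides turns them
  into the same sum over \<open>i < Suc n\<close>.\<close>

lemma ff_trace_power:
  fixes x :: "'a::{field,finite}"
  assumes q: "q = CHAR('a) ^ r" and x: "x ^ q ^ n = x"
  shows "ff_trace q n x ^ q = ff_trace q n x"
proof -
  have "ff_trace q n x ^ q = (\<Sum>i<n. x ^ q ^ Suc i)"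
    unfolding ff_trace_def
    by (subst freshmans_dream_sum'[OF prime_CHAR_finite q])
      (simp add: mult.commute flip: power_mult)
  also have "\<dots> + x = (\<Sum>i<Suc n. x ^ q ^ i)"
    by (subst sum.lessThan_Suc_shift) (simp add: add.commute)
  also have "\<dots> = ff_trace q n x + x"
    by (simp add: ff_trace_def x)
  finally show ?thesis by simp
qed

text \<open>The trace is a nonzero polynomial of degree at most \<open>q ^ (n - 1)\<close>, so it
  cannot vanish on a larger set. A general \<open>A\<close> serves both the trace of the whole field
  and that of a subfield down to the prime field.\<close>

lemma ff_trace_nonzero:
  fixes A :: "'a::{field,finite} set"
  assumes "q \<ge> 2" "n > 0" "card A > q ^ (n - 1)"
  obtains x where "x \<in> A" "ff_trace q n x \<noteq> 0"
proof -
  define P :: "'a poly" where "P = (\<Sum>i<n. Polynomial.monom 1 (q ^ i))"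
  have P: "poly P x = ff_trace q n x" for x
    by (simp add: P_def poly_sum poly_monom ff_trace_def)
  \<comment> \<open>Only \<open>i = 0\<close> gives the exponent 1, since
    \<open>q \<ge> 2\<close>.\<close>
  have "Polynomial.coeff P 1 = (\<Sum>i<n. if i = 0 then 1 else 0)"
    unfolding P_def Polynomial.coeff_sum using assms(1) by (intro sum.cong) auto
  also have "\<dots> = 1" using assms(2) by simp
  finally have P0: "P \<noteq> 0" by auto
  have "Polynomial.degree P \<le> q ^ (n - 1)"
    unfolding P_def using assms
    by (intro degree_sum_le) (auto intro!: order.trans[OF degree_monom_le] power_increasing)
  then have "card {x. poly P x = 0} < card A"
    using card_poly_roots_bound[OF P0] assms by linarith
  then have "\<not> A \<subseteq> {x. poly P x = 0}"
    using card_mono[of "{x. poly P x = 0}" A] by auto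
  with that P show ?thesis by auto
qed

section \<open>Characters and Gauss sums\<close>

definition add_character :: "'a::field set \<Rightarrow> ('a \<Rightarrow> complex) \<Rightarrow> bool" where
  "add_character K \<psi> \<longleftrightarrow>
     (\<forall>x\<in>K. \<forall>y\<in>K. \<psi> (x + y) = \<psi> x * \<psi> y) \<and> (\<forall>x\<in>K. cmod (\<psi> x) = 1)"

text \<open>Only nonzero arguments in \<open>K\<close> are constrained, so a character of the large
  field serves unchanged as a character of a subfield.\<close>

definition mult_character :: "'a::field set \<Rightarrow> ('a \<Rightarrow> complex) \<Rightarrow> bool" where
  "mult_character K \<chi> \<longleftrightarrow>
     (\<forall>x\<in>K-{0}. \<forall>y\<in>K-{0}. \<chi> (x * y) = \<chi> x * \<chi> y) \<and> (\<forall>x\<in>K-{0}. cmod (\<chi> x) = 1)"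

section \<open>Roots of unity, existence and orthogonality of characters\<close>

lemma cis_eq_1_iff: "cis x = 1 \<longleftrightarrow> (\<exists>k::int. x = 2 * pi * of_int k)"
proof -
  have "cis x = 1 \<longleftrightarrow> cos x = 1"
    using sin_cos_squared_add[of x] by (auto simp: complex_eq_iff power2_eq_square)
  then show ?thesis by (simp add: cos_one_2pi_int mult_ac)
qed

lemma cis_nat_div_eq_1_iff:
  fixes k N :: nat
  assumes "N > 0"
  shows "cis (2 * pi * real k / real N) = 1 \<longleftrightarrow> N dvd k"
proof -
  have "cis (2 * pi * real k / real N) = 1 \<longleftrightarrow> (\<exists>l::int. real k = real N * of_int l)"
    using assms by (simp add: cis_eq_1_iff field_simps)
  also have "\<dots> \<longleftrightarrow> (\<exists>l::int. int k = int N * l)"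
    by (metis of_int_eq_iff of_int_mult of_int_of_nat_eq)
  also have "\<dots> \<longleftrightarrow> N dvd k"
    by (metis dvd_def int_dvd_int_iff)
  finally show ?thesis .
qed

lemma cis_nat_div_cong:
  assumes "[k = l] (mod N)" "N > 0"
  shows "cis (2 * pi * real k / real N) = cis (2 * pi * real l / real N)"
proof -
  have *: "cis (2 * pi * real k / real N) = cis (2 * pi * real (k mod N) / real N)" for k
  proof -
    have "real k = real (k mod N) + real N * real (k div N)"
      by (metis mod_mult_div_eq of_nat_add of_nat_mult)
    then have "2 * pi * real k / real N = 2 * pi * real (k mod N) / real N + 2 * pi * real (k div N)"
      using assms(2) by (simp add: field_simps)
    moreover have "cis (2 * pi * real (k div N)) = 1"
      using cis_nat_div_eq_1_iff[of 1 "k div N"] by simp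
    ultimately show ?thesis
      by (metis cis_mult mult.right_neutral)
  qed
  show ?thesis
    using *[of k] *[of l] assms by (simp add: cong_def)
qed

text \<open>This is the canonical character exp(2 pi i Tr(x) / p), with Tr the trace from
  \<open>K\<close> to the prime field. It is nontrivial because Tr does not vanish on all of
  \<open>K\<close>.\<close>

lemma nontrivial_add_character_exists:
  fixes K :: "'a::{field,finite} set"
  assumes K: "is_subfield K" and card: "card K = CHAR('a) ^ r" and "r > 0"
  obtains \<psi> where "add_character K \<psi>" "\<exists>x\<in>K. \<psi> x \<noteq> 1"
proof -
  define p where "p = CHAR('a)"
  have p: "prime p" unfolding p_def by (rule prime_CHAR_finite)
  define F :: "'a set" where "F = of_nat ` {..<p}"
  have "inj_on (of_nat :: nat \<Rightarrow> 'a) {..<p}"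
    by (auto simp: inj_on_def of_nat_eq_iff_cong_CHAR p_def cong_def)
  then have cF: "card F = p" by (simp add: F_def card_image)
  have of_nat_F: "of_nat k \<in> F" for k
    unfolding F_def using p
    by (intro image_eqI[of _ _ "k mod p"])
      (auto simp: of_nat_eq_iff_cong_CHAR p_def cong_def prime_gt_0_nat)
  have pow_of_nat: "(of_nat k :: 'a) ^ p = of_nat k" for k
  proof (induction k)
    case (Suc k)
    then show ?case
      using freshmans_dream[OF prime_CHAR_finite, of p "1::'a" "of_nat k"] by (simp add: p_def)
  qed (use p in \<open>simp add: prime_gt_0_nat\<close>)
  \<comment> \<open>The \<open>p\<close> elements of \<open>F\<close> exhaust the roots of X^p -
    X.\<close>
  have F: "x \<in> F" if "x ^ p = x" for x
  proof -
    have "card {x::'a. x ^ p = x} \<le> card F"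
      unfolding cF using prime_ge_2_nat[OF p] by (rule card_power_eq_self_le)
    then have "F = {x. x ^ p = x}"
      by (intro card_seteq) (auto simp: F_def pow_of_nat)
    with that show ?thesis by blast
  qed
  \<comment> \<open>A lift from the prime field to the naturals. It is determined only modulo
    \<open>p\<close>, and \<open>\<psi>\<close> is insensitive to multiples of
    \<open>p\<close>.\<close>
  define ind :: "'a \<Rightarrow> nat" where "ind x = (SOME k. of_nat k = x)" for x
  have ind: "of_nat (ind x) = x" if "x \<in> F" for x
    unfolding ind_def using that by (intro someI_ex[of "\<lambda>k. of_nat k = x"]) (auto simp: F_def)
  define \<psi> where "\<psi> x = cis (2 * pi * real (ind (ff_trace p r x)) / real p)" for x
  have tr: "ff_trace p r x \<in> F" if "x \<in> K" for x
  proof (rule F)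
    have "x ^ p ^ r = x"
      using subfield_power_card[OF K that] card by (simp add: p_def)
    then show "ff_trace p r x ^ p = ff_trace p r x"
      using ff_trace_power[of p 1 x r] by (simp add: p_def)
  qed
  have "add_character K \<psi>"
    unfolding add_character_def
  proof (intro conjI ballI)
    fix x y assume xy: "x \<in> K" "y \<in> K"
    then have "x + y \<in> K" using K by (auto simp: is_subfield_def)
    have "of_nat (ind (ff_trace p r (x + y))) = ff_trace p r (x + y)"
      by (rule ind[OF tr[OF \<open>x + y \<in> K\<close>]])
    also have "\<dots> = ff_trace p r x + ff_trace p r y"
      by (rule ff_trace_add[where r = 1]) (simp add: p_def)
    also have "\<dots> = of_nat (ind (ff_trace p r x) + ind (ff_trace p r y))"
      by (simp add: ind tr xy)
    finally have "[ind (ff_trace p r (x + y)) = ind (ff_trace p r x) + ind (ff_trace p r y)] (mod p)"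
      by (simp only: of_nat_eq_iff_cong_CHAR p_def)
    then have "\<psi> (x + y) = cis (2 * pi * real (ind (ff_trace p r x) + ind (ff_trace p r y)) / real p)"
      unfolding \<psi>_def using p by (intro cis_nat_div_cong) (auto simp: prime_gt_0_nat)
    also have "\<dots> = \<psi> x * \<psi> y"
      by (simp add: \<psi>_def cis_mult ring_distribs add_divide_distrib)
    finally show "\<psi> (x + y) = \<psi> x * \<psi> y" .
  qed (simp add: \<psi>_def)
  moreover obtain x where x: "x \<in> K" "ff_trace p r x \<noteq> 0"
  proof (rule ff_trace_nonzero[of p r K])
    show "card K > p ^ (r - 1)"
      using p \<open>r > 0\<close> card by (simp add: p_def prime_gt_Suc_0_nat)
  qed (use p \<open>r > 0\<close> in \<open>auto simp: prime_ge_2_nat\<close>)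
  have "\<psi> x \<noteq> 1"
  proof
    assume "\<psi> x = 1"
    then have "p dvd ind (ff_trace p r x)"
      unfolding \<psi>_def using p by (subst (asm) cis_nat_div_eq_1_iff) (auto simp: prime_gt_0_nat)
    then have "of_nat (ind (ff_trace p r x)) = (0::'a)"
      by (simp add: of_nat_eq_0_iff_char_dvd p_def)
    with ind[OF tr[OF x(1)]] x(2) show False by simp
  qed
  ultimately show ?thesis using that x(1) by blast
qed

text \<open>For \<open>a \<noteq> 0\<close>, translating by \<open>b / a\<close> with
  \<open>\<psi> b \<noteq> 1\<close> reproduces the sum multiplied by \<open>\<psi> b\<close>, so it
  is 0.\<close>

lemma sum_add_character:
  fixes K :: "'a::{field,finite} set"
  assumes K: "is_subfield K" and \<psi>: "add_character K \<psi>" "\<exists>x\<in>K. \<psi> x \<noteq> 1" and a: "a \<in> K"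
  shows "(\<Sum>x\<in>K. \<psi> (a * x)) = (if a = 0 then of_nat (card K) else 0)"
proof (cases "a = 0")
  case True
  have "\<psi> 0 \<noteq> 0" "\<psi> (0 + 0) = \<psi> 0 * \<psi> 0"
    using \<psi>(1) K unfolding add_character_def is_subfield_def by fastforce+
  then have "\<psi> 0 = 1" by simp
  with True show ?thesis by simp
next
  case False
  obtain b where b: "b \<in> K" "\<psi> b \<noteq> 1" using \<psi>(2) by blast
  have ba: "b / a \<in> K" using K b a by (intro is_subfield_divide)
  have Kadd: "x + y \<in> K" if "x \<in> K" "y \<in> K" for x y
    using K that by (auto simp: is_subfield_def)
  let ?S = "\<Sum>x\<in>K. \<psi> (a * x)"
  have "?S = (\<Sum>x\<in>K. \<psi> (a * x + b))"
    by (rule sum.reindex_bij_witness[of _ "\<lambda>x. x + b / a" "\<lambda>x. x - b / a"])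
      (use False K ba in \<open>auto intro: is_subfield_diff Kadd simp: distrib_left right_diff_distrib\<close>)
  also have "\<dots> = (\<Sum>x\<in>K. \<psi> b * \<psi> (a * x))"
    using \<psi>(1) K a b unfolding add_character_def is_subfield_def by (intro sum.cong) auto
  also have "\<dots> = \<psi> b * ?S" by (simp add: sum_distrib_left)
  finally have "?S * (\<psi> b - 1) = 0" by (simp add: algebra_simps)
  with b False show ?thesis by simp
qed

text \<open>As for additive characters, with scaling by some \<open>b\<close> with
  \<open>\<chi> b \<noteq> 1\<close> in place of translation.\<close>

lemma sum_mult_character:
  fixes K :: "'a::{field,finite} set"
  assumes K: "is_subfield K" and \<chi>: "mult_character K \<chi>"
  shows "(\<Sum>x\<in>K-{0}. \<chi> x) = (if \<forall>x\<in>K-{0}. \<chi> x = 1 then of_nat (card K - 1) else 0)"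
proof (cases "\<forall>x\<in>K-{0}. \<chi> x = 1")
  case True
  then have "(\<Sum>x\<in>K-{0}. \<chi> x) = (\<Sum>x\<in>K-{0}. 1)" by (intro sum.cong) auto
  with True show ?thesis using K by (simp add: card_Diff_singleton is_subfield_def)
next
  case False
  then obtain b where b: "b \<in> K" "b \<noteq> 0" "\<chi> b \<noteq> 1" by blast
  let ?S = "\<Sum>x\<in>K-{0}. \<chi> x"
  have "?S = (\<Sum>x\<in>K-{0}. \<chi> (b * x))"
    by (rule sum.reindex_bij_witness[of _ "\<lambda>x. b * x" "\<lambda>x. x / b"])
      (use K b in \<open>auto intro: is_subfield_divide simp: is_subfield_def field_simps\<close>)
  also have "\<dots> = (\<Sum>x\<in>K-{0}. \<chi> b * \<chi> x)"
    using \<chi> b unfolding mult_character_def by (intro sum.cong) auto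
  also have "\<dots> = \<chi> b * ?S" by (simp add: sum_distrib_left)
  finally have "?S * (\<chi> b - 1) = 0" by (simp add: algebra_simps)
  with b False show ?thesis by auto
qed

text \<open>The inequality also covers the trivial \<open>\<chi>\<close>, for which the sum is \<open>-1\<close>; hence no case
  distinction on the order of a character is needed later.\<close>

lemma gauss_sum_norm_le:
  fixes K :: "'a::{field,finite} set"
  assumes K: "is_subfield K" and \<psi>: "add_character K \<psi>" "\<exists>x\<in>K. \<psi> x \<noteq> 1"
    and \<chi>: "mult_character K \<chi>"
  shows "cmod (\<Sum>x\<in>K-{0}. \<chi> x * \<psi> x) \<le> sqrt (card K)"
proof -
  let ?G = "\<Sum>x\<in>K-{0}. \<chi> x * \<psi> x"
  have K0: "0 \<in> K" and Kmult: "\<And>x y. x \<in> K \<Longrightarrow> y \<in> K \<Longrightarrow> x * y \<in> K"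
    using K by (auto simp: is_subfield_def)
  have \<chi>1: "\<chi> x * cnj (\<chi> x) = 1" if "x \<in> K" "x \<noteq> 0" for x
    using \<chi> that by (simp add: mult_character_def flip: complex_norm_square)
  have \<psi>1: "\<psi> x * cnj (\<psi> x) = 1" if "x \<in> K" for x
    using \<psi> that by (simp add: add_character_def flip: complex_norm_square)
  have "complex_of_real ((cmod ?G)\<^sup>2) = ?G * cnj ?G"
    by (rule complex_norm_square)
  also have "\<dots> = (\<Sum>y\<in>K-{0}. \<Sum>x\<in>K-{0}. \<chi> x * \<psi> x * cnj (\<chi> y * \<psi> y))"
    by (subst sum.swap) (simp add: sum_product)
  \<comment> \<open>Substituting \<open>x = t * y\<close> cancels \<open>\<chi> y\<close> and leaves
    an additive character of \<open>y\<close>, which orthogonality sums for each fixed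
    \<open>t\<close>.\<close>
  also have "\<dots> = (\<Sum>y\<in>K-{0}. \<Sum>t\<in>K-{0}. \<chi> t * \<psi> ((t - 1) * y))"
  proof (rule sum.cong[OF refl])
    fix y assume y: "y \<in> K - {0}"
    have "(\<Sum>x\<in>K-{0}. \<chi> x * \<psi> x * cnj (\<chi> y * \<psi> y)) =
          (\<Sum>t\<in>K-{0}. \<chi> (t * y) * \<psi> (t * y) * cnj (\<chi> y * \<psi> y))"
      by (rule sum.reindex_bij_witness[of _ "\<lambda>t. t * y" "\<lambda>x. x / y"])
        (use K y in \<open>auto intro: is_subfield_divide Kmult\<close>)
    also have "\<dots> = (\<Sum>t\<in>K-{0}. \<chi> t * \<psi> ((t - 1) * y))"
    proof (rule sum.cong[OF refl])
      fix t assume t: "t \<in> K - {0}"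
      have "\<psi> (t * y) = \<psi> ((t - 1) * y + y)" by (simp add: algebra_simps)
      also have "\<dots> = \<psi> ((t - 1) * y) * \<psi> y"
      proof -
        have "(t - 1) * y \<in> K"
          using K y t by (intro Kmult is_subfield_diff) (auto simp: is_subfield_def)
        then show ?thesis using \<psi>(1) y by (simp add: add_character_def)
      qed
      finally have "\<chi> (t * y) * \<psi> (t * y) * cnj (\<chi> y * \<psi> y) =
          (\<chi> t * \<chi> y) * (\<psi> ((t - 1) * y) * \<psi> y) * cnj (\<chi> y * \<psi> y)"
        using \<chi> t y by (simp add: mult_character_def)
      also have "\<dots> = \<chi> t * \<psi> ((t - 1) * y) * (\<chi> y * cnj (\<chi> y)) * (\<psi> y * cnj (\<psi> y))"
        by (simp add: mult_ac)
      finally show "\<chi> (t * y) * \<psi> (t * y) * cnj (\<chi> y * \<psi> y) = \<chi> t * \<psi> ((t - 1) * y)"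
        using y \<chi>1[of y] \<psi>1[of y] by (simp only: Diff_iff singleton_iff mult_1_right not_False_eq_True)
    qed
    finally show "(\<Sum>x\<in>K-{0}. \<chi> x * \<psi> x * cnj (\<chi> y * \<psi> y)) =
        (\<Sum>t\<in>K-{0}. \<chi> t * \<psi> ((t - 1) * y))" .
  qed
  also have "\<dots> = (\<Sum>t\<in>K-{0}. \<chi> t * (\<Sum>y\<in>K-{0}. \<psi> ((t - 1) * y)))"
    by (subst sum.swap) (simp add: sum_distrib_left)
  \<comment> \<open>Orthogonality over all of \<open>K\<close>, minus the term
    \<open>y = 0\<close>.\<close>
  also have "\<dots> = (\<Sum>t\<in>K-{0}. \<chi> t * ((if t = 1 then of_nat (card K) else 0) - 1))"
  proof (rule sum.cong[OF refl])
    fix t assume t: "t \<in> K - {0}"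
    then have t1: "t - 1 \<in> K" using K by (intro is_subfield_diff) (auto simp: is_subfield_def)
    have "\<psi> 0 = 1"
      using sum_add_character[OF K \<psi> K0] K0 by (auto simp: card_gt_0_iff)
    then have "(\<Sum>y\<in>K-{0}. \<psi> ((t - 1) * y)) = (\<Sum>y\<in>K. \<psi> ((t - 1) * y)) - 1"
      using K0 by (simp add: sum_diff1)
    then show "\<chi> t * (\<Sum>y\<in>K-{0}. \<psi> ((t - 1) * y)) =
        \<chi> t * ((if t = 1 then of_nat (card K) else 0) - 1)"
      using sum_add_character[OF K \<psi> t1] by simp
  qed
  also have "\<dots> = (\<Sum>t\<in>K-{0}. if t = 1 then \<chi> 1 * of_nat (card K) else 0) - (\<Sum>t\<in>K-{0}. \<chi> t)"
    by (subst sum_subtractf[symmetric]) (auto intro!: sum.cong simp: right_diff_distrib split: if_splits)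
  also have "(\<Sum>t\<in>K-{0}. if t = 1 then \<chi> 1 * of_nat (card K) else 0) = of_nat (card K)"
  proof -
    have "1 \<in> K - {0}" using K by (auto simp: is_subfield_def)
    with \<chi> have "\<chi> (1 * 1) = \<chi> 1 * \<chi> 1" "cmod (\<chi> 1) = 1"
      unfolding mult_character_def by blast+
    then have "\<chi> 1 = 1" by auto
    with \<open>1 \<in> K - {0}\<close> show ?thesis by simp
  qed
  \<comment> \<open>The squared norm is thus \<open>card K\<close> for nontrivial
    \<open>\<chi>\<close> and 1 for trivial \<open>\<chi>\<close>.\<close>
  also have "of_nat (card K) - (\<Sum>t\<in>K-{0}. \<chi> t) =
      complex_of_real (real (card K) - (if \<forall>x\<in>K-{0}. \<chi> x = 1 then real (card K - 1) else 0))"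
    by (simp add: sum_mult_character[OF K \<chi>])
  finally have "(cmod ?G)\<^sup>2 =
      real (card K) - (if \<forall>x\<in>K-{0}. \<chi> x = 1 then real (card K - 1) else 0)"
    by (simp only: of_real_eq_iff)
  also have "\<dots> \<le> real (card K)" by simp
  finally show ?thesis by (rule real_le_rsqrt)
qed

section \<open>Characters of the cyclic multiplicative group\<close>

lemma finite_field_generator_exists:
  obtains g :: "'a::{field,finite}" where "g \<noteq> 0" "\<And>x. x \<noteq> 0 \<Longrightarrow> \<exists>k. x = g ^ k"
proof -
  \<comment> \<open>The type is packaged as an explicit ring record, to which the cyclicity of the
    multiplicative group of a finite field applies.\<close>
  define R :: "'a ring" where
    "R = \<lparr>carrier = UNIV, monoid.mult = (*), one = 1, ring.zero = 0, add = (+)\<rparr>"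
  have "\<exists>y. x + y = 0" for x :: 'a using add.right_inverse by blast
  moreover have "x \<noteq> 0 \<Longrightarrow> \<exists>y. x * y = 1" for x :: 'a
    by (rule exI[of _ "inverse x"]) auto
  ultimately have "field R"
    unfolding R_def using add.right_inverse
    by unfold_locales (auto simp: algebra_simps Units_def)
  then interpret field R .
  have pow: "x [^]\<^bsub>R\<^esub> k = x ^ k" for x :: 'a and k :: nat
    by (induction k) (simp_all add: R_def mult.commute)
  obtain g where g: "g \<in> carrier (mult_of R)"
    "carrier (mult_of R) = {g [^]\<^bsub>R\<^esub> i | i::nat. i \<in> UNIV}"
    using finite_field_mult_group_has_gen by (auto simp: R_def)
  have "carrier (mult_of R) = UNIV - {0}" by (simp add: R_def)
  with g pow have "UNIV - {0} = {g ^ i | i. True}" "g \<noteq> 0" by auto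
  with that show ?thesis by blast
qed

text \<open>A fixed generator identifies the unit group with the residues modulo \<open>N\<close>,
  which gives its characters explicit formulas.\<close>

locale field_generator =
  fixes g :: "'a::{field,finite}" and N :: nat
  assumes N_eq: "N = CARD('a) - 1" and g_nz: "g \<noteq> 0" and gen: "x \<noteq> 0 \<Longrightarrow> \<exists>k. x = g ^ k"
begin

lemma N_pos: "N > 0"
proof -
  have "card {0, 1 :: 'a} \<le> CARD('a)" by (intro card_mono) auto
  then show ?thesis by (simp add: N_eq)
qed

lemma power_N: "x \<noteq> 0 \<Longrightarrow> (x::'a) ^ N = 1"
proof -
  assume "x \<noteq> 0"
  have "x * x ^ N = x ^ CARD('a)" using N_pos by (simp add: N_eq flip: power_Suc)
  also have "\<dots> = x * 1" using subfield_power_card[OF is_subfield_UNIV, of x] by simp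
  finally show ?thesis using \<open>x \<noteq> 0\<close> by simp
qed

lemma gen_power_mod: "g ^ (k mod N) = g ^ k"
proof -
  have "g ^ k = g ^ (N * (k div N) + k mod N)" by simp
  also have "\<dots> = g ^ (k mod N)"
    by (simp only: power_add power_mult power_N[OF g_nz]) simp
  finally show ?thesis ..
qed

lemma bij_betw_gen_power: "bij_betw (\<lambda>k. g ^ k) {..<N} (UNIV - {0})"
proof -
  have "(\<lambda>k. g ^ k) ` {..<N} = UNIV - {0}"
  proof (intro equalityI subsetI)
    fix x :: 'a assume "x \<in> UNIV - {0}"
    then obtain k where "x = g ^ k" using gen by blast
    then show "x \<in> (\<lambda>k. g ^ k) ` {..<N}"
      using N_pos gen_power_mod[of k] by (intro image_eqI[of _ _ "k mod N"]) auto
  qed (use g_nz in auto)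
  moreover have "card (UNIV - {0::'a}) = card {..<N}" by (simp add: card_Diff_singleton N_eq)
  ultimately show ?thesis
    by (simp add: bij_betw_def eq_card_imp_inj_on)
qed

lemma gen_power_eq_iff: "g ^ k = g ^ l \<longleftrightarrow> [k = l] (mod N)"
proof
  assume "g ^ k = g ^ l"
  then have "g ^ (k mod N) = g ^ (l mod N)" by (simp only: gen_power_mod)
  then show "[k = l] (mod N)"
    using bij_betw_gen_power N_pos unfolding bij_betw_def inj_on_def cong_def by auto
next
  assume "[k = l] (mod N)"
  then show "g ^ k = g ^ l" by (metis cong_def gen_power_mod)
qed

lemma sum_nonzero_eq: "(\<Sum>x\<in>UNIV-{0}. f x) = (\<Sum>k<N. f (g ^ k))"
  using sum.reindex_bij_betw[OF bij_betw_gen_power, of f] by simp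

definition dlog :: "'a \<Rightarrow> nat" where "dlog x = (SOME k. x = g ^ k)"

lemma gen_power_dlog: "x \<noteq> 0 \<Longrightarrow> g ^ dlog x = x"
  unfolding dlog_def using someI_ex[OF gen, of x] by simp

text \<open>For nonzero \<open>x\<close>, \<open>dlog x\<close> is determined only modulo
  \<open>N\<close>, which does not affect \<open>cis\<close>. Adding indices multiplies characters,
  and index 0 is the trivial one.\<close>

definition chi :: "nat \<Rightarrow> 'a \<Rightarrow> complex" where
  "chi j x = cis (2 * pi * real (j * dlog x) / real N)"

lemma chi_gen_power: "chi j (g ^ k) = cis (2 * pi * real (j * k) / real N)"
  unfolding chi_def
proof (rule cis_nat_div_cong)
  have "g ^ dlog (g ^ k) = g ^ k" using g_nz by (simp add: gen_power_dlog)
  then show "[j * dlog (g ^ k) = j * k] (mod N)"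
    by (intro cong_scalar_left) (simp only: gen_power_eq_iff)
qed (rule N_pos)

lemma chi_0 [simp]: "chi 0 x = 1"
  by (simp add: chi_def)

lemma norm_chi [simp]: "cmod (chi j x) = 1"
  by (simp add: chi_def)

lemma chi_add: "chi (i + j) x = chi i x * chi j x"
  by (simp add: chi_def cis_mult ring_distribs add_divide_distrib)

lemma chi_mult:
  assumes "x \<noteq> 0" "y \<noteq> 0"
  shows "chi j (x * y) = chi j x * chi j y"
proof -
  obtain k l where "x = g ^ k" "y = g ^ l" using gen assms by meson
  moreover have "chi j (g ^ (k + l)) = chi j (g ^ k) * chi j (g ^ l)"
    by (simp only: chi_gen_power cis_mult) (simp add: ring_distribs add_divide_distrib)
  ultimately show ?thesis by (simp add: power_add)
qed

lemma mult_character_chi: "mult_character K (chi j)"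
  by (simp add: mult_character_def chi_mult)

lemma chi_times_cnj: "chi j x * cnj (chi j x) = 1"
  by (simp flip: complex_norm_square)

lemma chi_square: "x \<noteq> 0 \<Longrightarrow> chi j (x\<^sup>2) = chi (2 * j) x"
  by (simp add: power2_eq_square chi_mult mult_2 chi_add)

text \<open>Identifies \<open>chi M\<close> as the quadratic character.\<close>

lemma chi_half:
  assumes "N = 2 * M"
  shows "chi M (g ^ k) = (-1) ^ k"
proof -
  have "M > 0" using assms N_pos by simp
  then have "2 * pi * real (M * k) / real N = real k * pi" by (simp add: assms)
  then have "chi M (g ^ k) = cis (real k * pi)" unfolding chi_gen_power by (rule arg_cong)
  also have "\<dots> = (-1) ^ k" by (simp flip: Complex.DeMoivre)
  finally show ?thesis .
qed

text \<open>-1 is \<open>g ^ M\<close>, and index and exponent enter \<open>chi\<close>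
  symmetrically, so the value is that of the quadratic character at \<open>g ^ j\<close>.\<close>

lemma chi_minus_one_odd:
  assumes N: "N = 2 * M" and "odd j"
  shows "chi j (-1) = -1"
proof -
  have M: "M > 0" using N N_pos by simp
  have "(g ^ M)\<^sup>2 = 1" using power_N[OF g_nz] by (simp add: N mult.commute flip: power_mult)
  moreover have "g ^ M \<noteq> g ^ 0"
    unfolding gen_power_eq_iff using M N by (simp add: cong_def)
  ultimately have "g ^ M = -1" by (simp add: power2_eq_1_iff)
  then have "chi j (-1) = chi j (g ^ M)" by simp
  also have "\<dots> = chi M (g ^ j)" by (simp only: chi_gen_power mult.commute)
  finally show ?thesis using chi_half[OF N] \<open>odd j\<close> by simp
qed

text \<open>A nonzero \<open>y\<close> has \<open>1 + chi M y\<close> square roots: the exponents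
  \<open>k\<close> and \<open>M + k\<close> have the same square, so every even exponent is reached
  twice.\<close>

lemma sum_over_squares:
  fixes f :: "'a \<Rightarrow> complex"
  assumes N: "N = 2 * M"
  shows "(\<Sum>x\<in>UNIV-{0}. f (x\<^sup>2)) = (\<Sum>y\<in>UNIV-{0}. (1 + chi M y) * f y)"
proof -
  have split: "(\<Sum>k<M + L. h k) = (\<Sum>k<M. h k) + (\<Sum>k<L. h (M + k))" for h :: "nat \<Rightarrow> complex" and L
    by (induction L) (simp_all add: add.assoc)
  have evens: "(\<Sum>k<2*L. (1 + (-1)^k) * h k) = 2 * (\<Sum>k<L. h (2 * k))" for h :: "nat \<Rightarrow> complex" and L
    by (induction L) (simp_all add: algebra_simps)
  have per: "g ^ (2 * (M + k)) = g ^ (2 * k)" for k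
    unfolding gen_power_eq_iff N by (simp add: cong_def)
  have "(\<Sum>x\<in>UNIV-{0}. f (x\<^sup>2)) = (\<Sum>k<M + M. f (g ^ (2 * k)))"
    unfolding sum_nonzero_eq N by (simp add: mult_2 power_add power2_eq_square)
  also have "\<dots> = 2 * (\<Sum>k<M. f (g ^ (2 * k)))"
    unfolding split per by (rule mult_2[symmetric])
  also have "\<dots> = (\<Sum>k<2*M. (1 + (-1)^k) * f (g ^ k))"
    by (rule evens[symmetric])
  also have "\<dots> = (\<Sum>y\<in>UNIV-{0}. (1 + chi M y) * f y)"
    unfolding sum_nonzero_eq chi_half[OF N] by (simp add: N)
  finally show ?thesis .
qed

section \<open>Detecting m-free elements\<close>

text \<open>For \<open>d\<close> dividing \<open>N\<close>, \<open>g ^ k\<close> is a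
  \<open>d\<close>-th power exactly when \<open>d dvd k\<close>. The largest such divisor of
  \<open>m\<close> is \<open>gcd k m\<close>.\<close>

lemma m_free_gen_power_iff:
  assumes "m dvd N"
  shows "m_free m (g ^ k) \<longleftrightarrow> coprime k m"
proof
  assume mf: "m_free m (g ^ k)"
  define d where "d = gcd k m"
  have "g ^ k = (g ^ (k div d)) ^ d" by (simp add: d_def flip: power_mult)
  then show "coprime k m"
    using mf g_nz unfolding m_free_def d_def by (metis coprime_iff_gcd_eq_1 gcd_dvd2 power_not_zero)
next
  assume cop: "coprime k m"
  have *: "d = 1" if d: "d dvd m" "\<zeta> \<noteq> 0" "g ^ k = \<zeta> ^ d" for d \<zeta>
  proof -
    obtain l where "\<zeta> = g ^ l" using gen d(2) by blast
    with d(3) have "[k = l * d] (mod N)" by (simp add: gen_power_eq_iff flip: power_mult)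
    \<comment> \<open>The modulus \<open>N\<close> may be replaced by \<open>d\<close>, because
      \<open>d dvd m\<close> and \<open>m dvd N\<close>.\<close>
    then have "[k = l * d] (mod d)" using d(1) assms by (metis cong_dvd_modulus_nat dvd_trans)
    then have "d dvd k" by (simp add: cong_def mod_eq_0_iff_dvd)
    with cop d(1) show ?thesis using coprime_common_divisor_nat by auto
  qed
  show "m_free m (g ^ k)" unfolding m_free_def using power_not_zero[OF g_nz] * by blast
qed

end

text \<open>Coprimality to \<open>m\<close> has period \<open>m\<close>, so each of the
  \<open>c\<close> blocks contributes \<open>totient m\<close>.\<close>

lemma card_coprime_below_multiple:
  fixes m c :: nat
  assumes "m > 0"
  shows "card {k. k < m * c \<and> coprime k m} = c * totient m"
proof (induction c)
  case (Suc c)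
  \<comment> \<open>\<open>totatives m\<close> ranges over 1 to \<open>m\<close>, the block here
    over 0 to \<open>m - 1\<close>. The sets differ only for \<open>m = 1\<close>, where 0 is
    coprime to \<open>m\<close>.\<close>
  have tot: "card {k. k < m \<and> coprime k m} = totient m"
  proof (cases "m = 1")
    case False
    then have "{k. k < m \<and> coprime k m} = totatives m"
      using assms by (auto simp: totatives_def intro: Nat.gr0I le_neq_implies_less)
    then show ?thesis by (simp add: totient_def)
  qed (simp add: Collect_conv_if)
  have cop: "coprime (m * c + k) m \<longleftrightarrow> coprime k m" for k
    by (metis add.commute coprime_commute coprime_iff_gcd_eq_1 gcd_add_mult mult.commute)
  have eq: "{k. k < m * Suc c \<and> coprime k m} =
      {k. k < m * c \<and> coprime k m} \<union> (\<lambda>k. m * c + k) ` {k. k < m \<and> coprime k m}" (is "?A = ?B \<union> ?f ` ?C")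
  proof (intro equalityI subsetI)
    fix k assume k: "k \<in> ?A"
    show "k \<in> ?B \<union> ?f ` ?C"
    proof (cases "k < m * c")
      case False
      then have "k = m * c + (k - m * c)" by simp
      moreover from this k have "coprime (m * c + (k - m * c)) m" by simp
      then have "coprime (k - m * c) m"
        by (simp only: cop)
      ultimately show ?thesis using k False by (intro UnI2 image_eqI[of _ _ "k - m * c"]) auto
    qed (use k in auto)
  qed (auto simp: cop)
  have "card ?A = card ?B + card (?f ` ?C)"
    unfolding eq by (rule card_Un_disjoint) auto
  also have "card (?f ` ?C) = card ?C" by (rule card_image) (auto simp: inj_on_def)
  finally show ?case by (simp add: tot Suc.IH)
qed simp

context field_generator
begin

lemma card_m_free:
  assumes "m dvd N"
  shows "real (card {x::'a. m_free m x}) = theta m * real N"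
proof -
  obtain c where c: "N = m * c" using assms by blast
  have m: "m > 0" using c N_pos by (cases m) auto
  have "{x::'a. m_free m x} = (\<lambda>k. g ^ k) ` {k. k < m * c \<and> coprime k m}"
  proof (intro equalityI subsetI)
    fix x :: 'a assume x: "x \<in> {x. m_free m x}"
    then have "x \<in> (\<lambda>k. g ^ k) ` {..<N}"
      using bij_betw_gen_power by (auto simp: m_free_def bij_betw_def)
    with x show "x \<in> (\<lambda>k. g ^ k) ` {k. k < m * c \<and> coprime k m}"
      using m_free_gen_power_iff[OF assms] c by auto
  qed (use m_free_gen_power_iff[OF assms] in auto)
  moreover have "inj_on (\<lambda>k. g ^ k) {k. k < m * c \<and> coprime k m}"
    using bij_betw_gen_power unfolding bij_betw_def by (auto intro: inj_on_subset simp: c)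
  ultimately have "card {x::'a. m_free m x} = c * totient m"
    by (simp add: card_image card_coprime_below_multiple[OF m])
  then show ?thesis using m by (simp add: theta_def c)
qed

text \<open>For a prime \<open>p\<close> dividing \<open>N\<close>, \<open>avg p\<close> is the mean of the \<open>p - 1\<close> characters of exact order \<open>p\<close>.
Up to the factor \<open>1 - 1/p\<close>, \<open>1 - avg p\<close> is the indicator of the elements that are not \<open>p\<close>-th powers,
so \<open>sieve\<close> replaces the usual expansion over squarefree divisors with the Moebius function.\<close>

definition avg :: "nat \<Rightarrow> 'a \<Rightarrow> complex" where
  "avg p x = (\<Sum>i\<in>{1..<p}. chi (i * (N div p)) x) / of_nat (p - 1)"

definition sieve :: "nat set \<Rightarrow> 'a \<Rightarrow> complex" where
  "sieve P x = (\<Prod>p\<in>P. 1 - avg p x)"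

text \<open>At \<open>g ^ k\<close> the averaged characters take the values \<open>w ^ i\<close> for
  a \<open>p\<close>-th root of unity \<open>w\<close>. If \<open>p dvd k\<close> their mean is 1;
  otherwise they sum to -1, and \<open>1 - avg\<close> equals p / (p - 1), which the first factor
  normalizes.\<close>

lemma one_minus_avg:
  assumes p: "prime p" "p dvd N"
  shows "(1 - 1 / of_nat p) * (1 - avg p (g ^ k)) = of_bool (\<not> p dvd k)"
proof -
  define w where "w = cis (2 * pi * real k / real p)"
  have p0: "p > 1" using p prime_gt_1_nat by blast
  have w1: "w = 1 \<longleftrightarrow> p dvd k" unfolding w_def using p0 by (intro cis_nat_div_eq_1_iff) simp
  have wp: "w ^ p = 1"
    unfolding w_def Complex.DeMoivre using p0 cis_nat_div_eq_1_iff[of 1 k] by simp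
  have "chi (i * (N div p)) (g ^ k) = w ^ i" for i
  proof -
    obtain c where c: "N = p * c" using p by blast
    have "2 * pi * real (i * (N div p) * k) / real N = real i * (2 * pi * real k / real p)"
      using p0 c N_pos by (simp add: field_simps)
    then show ?thesis
      unfolding chi_gen_power w_def Complex.DeMoivre by (rule arg_cong)
  qed
  then have avg: "avg p (g ^ k) = (\<Sum>i\<in>{1..<p}. w ^ i) / of_nat (p - 1)"
    by (simp add: avg_def)
  show ?thesis
  proof (cases "p dvd k")
    case True
    then show ?thesis using avg p0 w1 by simp
  next
    case False
    have "{..<p} = insert 0 {1..<p}" using p0 by auto
    then have "(\<Sum>i<p. w ^ i) = 1 + (\<Sum>i\<in>{1..<p}. w ^ i)" by simp
    moreover have "(\<Sum>i<p. w ^ i) = 0"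
      using geometric_sum[of w p] w1 wp False by simp
    ultimately have "(\<Sum>i\<in>{1..<p}. w ^ i) = -1" by (simp add: add_eq_0_iff)
    then have "1 - avg p (g ^ k) = 1 + 1 / (of_nat p - 1)"
      unfolding avg using p0 by (simp add: of_nat_diff)
    moreover have "(of_nat p :: complex) \<noteq> 0" "(of_nat p :: complex) \<noteq> 1" using p0 by auto
    ultimately show ?thesis using False by (simp add: field_simps)
  qed
qed

text \<open>The Euler product of \<open>theta m\<close> supplies exactly the normalizing factors of
  \<open>one_minus_avg\<close>.\<close>

lemma m_free_indicator:
  assumes "m dvd N" "x \<noteq> 0"
  shows "of_bool (m_free m x) = of_real (theta m) * sieve (prime_factors m) x"
proof -
  obtain k where k: "x = g ^ k" using gen assms by blast
  have m: "m > 0" using assms N_pos by (cases m) auto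
  have "theta m = (\<Prod>p\<in>prime_factors m. 1 - 1 / real p)"
    unfolding theta_def totient_formula2 using m by simp
  then have "of_real (theta m) * sieve (prime_factors m) x =
      (\<Prod>p\<in>prime_factors m. (1 - 1 / of_nat p) * (1 - avg p x))"
    by (simp add: sieve_def prod.distrib)
  also have "\<dots> = (\<Prod>p\<in>prime_factors m. of_bool (\<not> p dvd k))"
  proof (rule prod.cong[OF refl])
    fix p assume "p \<in> prime_factors m"
    then have "prime p" "p dvd N" using assms by (auto simp: in_prime_factors_iff)
    then show "(1 - 1 / of_nat p) * (1 - avg p x) = of_bool (\<not> p dvd k)"
      unfolding k by (rule one_minus_avg)
  qed
  also have "\<dots> = of_bool (\<forall>p\<in>prime_factors m. \<not> p dvd k)"
    by (auto simp: prod_zero_iff)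
  also have "(\<forall>p\<in>prime_factors m. \<not> p dvd k) \<longleftrightarrow> coprime k m"
  proof
    assume *: "\<forall>p\<in>prime_factors m. \<not> p dvd k"
    show "coprime k m"
    proof (rule ccontr)
      assume "\<not> coprime k m"
      then have "gcd k m \<noteq> 1" using coprime_iff_gcd_eq_1 by blast
      then obtain p where "prime p" "p dvd gcd k m" using prime_factor_nat by blast
      with * m show False by (auto simp: in_prime_factors_iff)
    qed
  next
    assume "coprime k m"
    then show "\<forall>p\<in>prime_factors m. \<not> p dvd k"
      using coprime_common_divisor[of k m] not_prime_unit by (blast dest: in_prime_factors_imp_dvd in_prime_factors_imp_prime)
  qed
  finally show ?thesis by (simp add: k m_free_gen_power_iff[OF assms(1)])
qed

end

text \<open>Averaging costs no factor \<open>p - 1\<close>, so the eventual bound depends on the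
  number of primes and not on their sizes.\<close>

lemma norm_average_le:
  fixes f :: "nat \<Rightarrow> complex"
  assumes "p > 1" "\<And>i. cmod (f i) \<le> c"
  shows "cmod ((\<Sum>i\<in>{1..<p}. f i) / of_nat (p - 1)) \<le> c"
proof -
  have "cmod (\<Sum>i\<in>{1..<p}. f i) \<le> real (p - 1) * c"
    using sum_norm_le[of "{1..<p}" f "\<lambda>_. c"] assms by simp
  moreover have "real (p - 1) > 0" using assms(1) by simp
  ultimately show ?thesis
    by (simp only: norm_divide norm_of_nat pos_divide_le_eq mult.commute)
qed

section \<open>Character sums over a trace condition\<close>

locale trace_count = field_generator g N
  for g :: "'a::{field,finite}" and N :: nat +
  fixes K :: "'a set" and q n r M :: nat and \<psi> :: "'a \<Rightarrow> complex" and \<beta> :: 'a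
  assumes K: "is_subfield K" and card_K: "card K = q" and q: "q = CHAR('a) ^ r"
    and card: "CARD('a) = q ^ n" and n_pos: "n > 0" and NM: "N = 2 * M"
    and psi: "add_character K \<psi>" and psi_nontriv: "\<exists>x\<in>K. \<psi> x \<noteq> 1"
    and \<beta>: "\<beta> \<in> K" "\<beta> \<noteq> 0"
begin

definition tr :: "'a \<Rightarrow> 'a" where "tr = ff_trace q n"

definition Psi :: "'a \<Rightarrow> complex" where "Psi x = \<psi> (tr x)"

definition B :: real where "B = real q powr ((real n - 1) / 2)"

lemma q_ge_2: "q \<ge> 2"
proof -
  have "{0, 1} \<subseteq> K" using K by (auto simp: is_subfield_def)
  then have "card {0, 1 :: 'a} \<le> card K" by (intro card_mono) auto
  then show ?thesis by (simp add: card_K)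
qed

lemma tr_in_K: "tr x \<in> K"
proof -
  have "x ^ q ^ n = x" using subfield_power_card[OF is_subfield_UNIV, of x] card by simp
  then show ?thesis
    unfolding subfield_mem_iff_power_card[OF K] tr_def card_K by (rule ff_trace_power[OF q])
qed

lemma tr_mult: "u \<in> K \<Longrightarrow> tr (u * x) = u * tr x"
  unfolding tr_def using subfield_power_card[OF K] card_K by (intro ff_trace_mult) auto

lemma add_character_Psi: "add_character UNIV Psi"
  using psi tr_in_K ff_trace_add[OF q, of n]
  by (simp add: add_character_def Psi_def tr_def)

text \<open>Scaling an element of nonzero trace by \<open>K\<close> gives every value in
  \<open>K\<close> as a trace, in particular one where \<open>\<psi>\<close> is not 1.\<close>

lemma Psi_nontriv: "\<exists>x\<in>UNIV. Psi x \<noteq> 1"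
proof -
  obtain b where b: "b \<in> K" "\<psi> b \<noteq> 1" using psi_nontriv by blast
  obtain x where x: "tr x \<noteq> 0"
  proof (rule ff_trace_nonzero[of q n "UNIV :: 'a set"])
    show "q ^ (n - 1) < CARD('a)" using card n_pos q_ge_2 by simp
  qed (use q_ge_2 n_pos tr_def in auto)
  have "b / tr x \<in> K" using b K tr_in_K by (intro is_subfield_divide)
  then have "tr (b / tr x * x) = b / tr x * tr x" by (rule tr_mult)
  then have "tr (b / tr x * x) = b" using x by simp
  then have "Psi (b / tr x * x) \<noteq> 1" using b by (simp add: Psi_def)
  then show ?thesis by blast
qed

lemma psi_0: "\<psi> 0 = 1"
proof -
  have "0 \<in> K" using K by (simp add: is_subfield_def)
  from sum_add_character[OF K psi psi_nontriv this] show ?thesis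
    using card_K q_ge_2 by simp
qed

text \<open>The subtracted density \<open>1 / q\<close> is the \<open>u = 0\<close> term of the
  additive character expansion, so only nontrivial additive characters remain in
  \<open>deviation_eq\<close>.\<close>

definition deviation :: "'a \<Rightarrow> complex" where
  "deviation x = of_bool (tr (x\<^sup>2) = \<beta>) - 1 / of_nat q"

definition E :: "('a \<Rightarrow> complex) \<Rightarrow> complex" where
  "E h = (\<Sum>x\<in>UNIV-{0}. h x * deviation x)"

lemma deviation_eq:
  "deviation x = (\<Sum>u\<in>K-{0}. \<psi> (- (u * \<beta>)) * Psi (u * x\<^sup>2)) / of_nat q"
proof -
  let ?t = "tr (x\<^sup>2)"
  have K0: "0 \<in> K" using K by (simp add: is_subfield_def)
  have "?t - \<beta> \<in> K" using K tr_in_K \<beta> by (intro is_subfield_diff)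
  then have "(\<Sum>u\<in>K. \<psi> ((?t - \<beta>) * u)) = of_nat q * of_bool (?t = \<beta>)"
    by (simp add: sum_add_character[OF K psi psi_nontriv] card_K)
  moreover have "(\<Sum>u\<in>K. \<psi> ((?t - \<beta>) * u)) = 1 + (\<Sum>u\<in>K-{0}. \<psi> ((?t - \<beta>) * u))"
    using K0 psi_0 by (simp add: sum.remove)
  moreover have "(\<Sum>u\<in>K-{0}. \<psi> ((?t - \<beta>) * u)) = (\<Sum>u\<in>K-{0}. \<psi> (- (u * \<beta>)) * Psi (u * x\<^sup>2))"
  proof (rule sum.cong[OF refl])
    fix u assume u: "u \<in> K - {0}"
    have "u * ?t \<in> K" "- (u * \<beta>) \<in> K"
      using K u tr_in_K \<beta> by (auto simp: is_subfield_def)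
    then have "\<psi> (- (u * \<beta>) + u * ?t) = \<psi> (- (u * \<beta>)) * \<psi> (u * ?t)"
      using psi unfolding add_character_def by blast
    then show "\<psi> ((?t - \<beta>) * u) = \<psi> (- (u * \<beta>)) * Psi (u * x\<^sup>2)"
      using u by (simp add: Psi_def tr_mult algebra_simps)
  qed
  ultimately have "of_nat q * of_bool (?t = \<beta>) =
      1 + (\<Sum>u\<in>K-{0}. \<psi> (- (u * \<beta>)) * Psi (u * x\<^sup>2))" by simp
  then show ?thesis using q_ge_2 by (simp add: deviation_def field_simps)
qed

text \<open>The conjugate arises from moving \<open>u\<close> out of the sum over the large field in
  \<open>sum_chi_Psi\<close>; the twist by \<open>\<beta>\<close> comes from
  \<open>deviation_eq\<close>.\<close>

definition gaussK :: "nat \<Rightarrow> complex" where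
  "gaussK i = (\<Sum>u\<in>K-{0}. cnj (chi i u) * \<psi> (- (u * \<beta>)))"

definition gaussF :: "nat \<Rightarrow> complex" where
  "gaussF i = (\<Sum>x\<in>UNIV-{0}. chi i x * Psi x)"

text \<open>Nontriviality rests on \<open>\<beta> \<noteq> 0\<close>: the twisted character takes
  the value \<open>\<psi> b\<close> at \<open>- b / \<beta>\<close>.\<close>

lemma add_character_twist:
  "add_character K (\<lambda>u. \<psi> (- (u * \<beta>)))" "\<exists>x\<in>K. \<psi> (- (x * \<beta>)) \<noteq> 1"
proof -
  show "add_character K (\<lambda>u. \<psi> (- (u * \<beta>)))"
    unfolding add_character_def
  proof (intro conjI ballI)
    fix x y assume "x \<in> K" "y \<in> K"
    then have "- (x * \<beta>) \<in> K" "- (y * \<beta>) \<in> K"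
      using K \<beta> by (auto simp: is_subfield_def)
    moreover have "- ((x + y) * \<beta>) = - (x * \<beta>) + - (y * \<beta>)" by (simp add: algebra_simps)
    ultimately show "\<psi> (- ((x + y) * \<beta>)) = \<psi> (- (x * \<beta>)) * \<psi> (- (y * \<beta>))"
      using psi unfolding add_character_def by metis
  next
    fix x assume "x \<in> K"
    then have "- (x * \<beta>) \<in> K" using K \<beta> by (auto simp: is_subfield_def)
    then show "cmod (\<psi> (- (x * \<beta>))) = 1" using psi by (simp add: add_character_def)
  qed
  obtain b where b: "b \<in> K" "\<psi> b \<noteq> 1" using psi_nontriv by blast
  have "- b / \<beta> \<in> K" using K b \<beta> by (intro is_subfield_divide) (auto simp: is_subfield_def)
  moreover have "\<psi> (- ((- b / \<beta>) * \<beta>)) \<noteq> 1" using b \<beta> by simp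
  ultimately show "\<exists>x\<in>K. \<psi> (- (x * \<beta>)) \<noteq> 1" by blast
qed

lemma norm_gaussK_le: "cmod (gaussK i) \<le> sqrt q"
  unfolding gaussK_def card_K[symmetric]
  by (rule gauss_sum_norm_le[OF K add_character_twist])
    (simp add: mult_character_def chi_mult)

lemma norm_gaussF_le: "cmod (gaussF i) \<le> sqrt (q ^ n)"
  using gauss_sum_norm_le[OF is_subfield_UNIV add_character_Psi Psi_nontriv mult_character_chi, of i]
  by (simp add: gaussF_def card)

lemma norm_gauss_product_le: "cmod (gaussK i * gaussF i / of_nat q) \<le> B"
proof -
  have q0: "real q > 0" using q_ge_2 by simp
  have "cmod (gaussK i * gaussF i / of_nat q) \<le> sqrt q * sqrt (q ^ n) / real q"
    using norm_gaussK_le norm_gaussF_le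
    by (simp add: norm_mult norm_divide divide_right_mono mult_mono)
  also have "\<dots> = real q powr (1/2) * real q powr (real n / 2) / real q powr 1"
    using q0 by (simp add: powr_half_sqrt[symmetric] powr_realpow[symmetric] powr_powr)
  also have "\<dots> = real q powr (1/2 + real n / 2 - 1)"
    by (simp only: powr_add powr_diff)
  also have "1/2 + real n / 2 - 1 = (real n - 1) / 2" by (simp add: field_simps)
  finally show ?thesis by (simp add: B_def)
qed

lemma sum_chi_Psi:
  assumes "u \<noteq> 0"
  shows "(\<Sum>y\<in>UNIV-{0}. chi i y * Psi (u * y)) = cnj (chi i u) * gaussF i"
proof -
  have "gaussF i = (\<Sum>y\<in>UNIV-{0}. chi i (u * y) * Psi (u * y))"
    unfolding gaussF_def
    by (rule sum.reindex_bij_witness[of _ "\<lambda>y. u * y" "\<lambda>x. x / u"]) (use assms in auto)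
  also have "\<dots> = chi i u * (\<Sum>y\<in>UNIV-{0}. chi i y * Psi (u * y))"
    using assms by (simp add: sum_distrib_left chi_mult mult.assoc)
  finally have "cnj (chi i u) * gaussF i =
      (chi i u * cnj (chi i u)) * (\<Sum>y\<in>UNIV-{0}. chi i y * Psi (u * y))"
    by (simp add: mult_ac)
  then show ?thesis by (simp add: chi_times_cnj)
qed

lemma E_chi:
  "E (chi j) = (\<Sum>u\<in>K-{0}. \<psi> (- (u * \<beta>)) * (\<Sum>x\<in>UNIV-{0}. chi j x * Psi (u * x\<^sup>2))) / of_nat q"
proof -
  have "E (chi j) =
      (\<Sum>x\<in>UNIV-{0}. \<Sum>u\<in>K-{0}. chi j x * (\<psi> (- (u * \<beta>)) * Psi (u * x\<^sup>2))) / of_nat q"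
    unfolding E_def deviation_eq by (simp add: sum_distrib_left sum_divide_distrib)
  also have "(\<Sum>x\<in>UNIV-{0}. \<Sum>u\<in>K-{0}. chi j x * (\<psi> (- (u * \<beta>)) * Psi (u * x\<^sup>2))) =
      (\<Sum>u\<in>K-{0}. \<psi> (- (u * \<beta>)) * (\<Sum>x\<in>UNIV-{0}. chi j x * Psi (u * x\<^sup>2)))"
    by (subst sum.swap) (simp add: sum_distrib_left mult_ac)
  finally show ?thesis .
qed

text \<open>Replacing \<open>x\<close> by \<open>- x\<close> preserves the square and changes the
  sign of \<open>chi j x\<close>.\<close>

lemma E_chi_odd:
  assumes "odd j"
  shows "E (chi j) = 0"
proof -
  have "(\<Sum>x\<in>UNIV-{0}. chi j x * Psi (u * x\<^sup>2)) = 0" (is "?S = 0") for u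
  proof -
    have "?S = (\<Sum>x\<in>UNIV-{0}. chi j (-1 * x) * Psi (u * (-1 * x)\<^sup>2))"
      by (rule sum.reindex_bij_witness[of _ uminus uminus]) auto
    also have "\<dots> = (\<Sum>x\<in>UNIV-{0}. - (chi j x * Psi (u * x\<^sup>2)))"
    proof (rule sum.cong[OF refl])
      fix x :: 'a assume "x \<in> UNIV - {0}"
      then have "chi j (-1 * x) = - chi j x"
        by (subst chi_mult) (simp_all add: chi_minus_one_odd[OF NM assms])
      then show "chi j (-1 * x) * Psi (u * (-1 * x)\<^sup>2) = - (chi j x * Psi (u * x\<^sup>2))" by simp
    qed
    also have "\<dots> = - ?S" by (rule sum_negf)
    finally show ?thesis by simp
  qed
  then show ?thesis by (simp add: E_chi)
qed

text \<open>Since \<open>chi (2 * i) x = chi i (x\<^sup>2)\<close>, counting square roots turns the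
  inner sum into one over all \<open>y\<close>, with characters \<open>chi i\<close> and
  \<open>chi (i + M)\<close>. In each of these \<open>u\<close> separates from
  \<open>y\<close>.\<close>

lemma E_chi_even:
  "E (chi (2 * i)) = gaussK i * gaussF i / of_nat q + gaussK (i + M) * gaussF (i + M) / of_nat q"
proof -
  have "(\<Sum>x\<in>UNIV-{0}. chi (2 * i) x * Psi (u * x\<^sup>2)) =
      cnj (chi i u) * gaussF i + cnj (chi (i + M) u) * gaussF (i + M)" if "u \<in> K - {0}" for u
  proof -
    have "(\<Sum>x\<in>UNIV-{0}. chi (2 * i) x * Psi (u * x\<^sup>2)) =
        (\<Sum>x\<in>UNIV-{0}. chi i (x\<^sup>2) * Psi (u * x\<^sup>2))"
      by (intro sum.cong) (simp_all add: chi_square)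
    also have "\<dots> = (\<Sum>y\<in>UNIV-{0}. (1 + chi M y) * (chi i y * Psi (u * y)))"
      by (rule sum_over_squares[OF NM])
    also have "\<dots> = (\<Sum>y\<in>UNIV-{0}. chi i y * Psi (u * y)) + (\<Sum>y\<in>UNIV-{0}. chi (i + M) y * Psi (u * y))"
      by (simp add: chi_add algebra_simps sum.distrib)
    finally show ?thesis using that by (simp add: sum_chi_Psi)
  qed
  then have "E (chi (2 * i)) = (\<Sum>u\<in>K-{0}. \<psi> (- (u * \<beta>)) *
      (cnj (chi i u) * gaussF i + cnj (chi (i + M) u) * gaussF (i + M))) / of_nat q"
    unfolding E_chi by (intro arg_cong[of _ _ "\<lambda>z. z / of_nat q"] sum.cong) auto
  also have "\<dots> = (gaussK i * gaussF i + gaussK (i + M) * gaussF (i + M)) / of_nat q"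
    by (simp only: gaussK_def sum_distrib_left sum_distrib_right sum.distrib distrib_left mult_ac)
  finally show ?thesis by (simp add: add_divide_distrib)
qed

lemma norm_E_chi_le: "cmod (E (chi j)) \<le> 2 * B"
proof (cases "odd j")
  case True
  then show ?thesis by (simp add: E_chi_odd B_def)
next
  case False
  then obtain i where "j = 2 * i" by blast
  then show ?thesis
    using norm_gauss_product_le[of i] norm_gauss_product_le[of "i + M"]
    by (simp only: E_chi_even) (intro norm_triangle_le, simp)
qed

text \<open>For trivial \<open>chi i\<close> both Gauss sums are -1 and their product gives
  \<open>1 / q\<close>. Only the quadratic term is left to estimate, hence \<open>B\<close> in place
  of \<open>2 * B\<close>.\<close>

lemma norm_E_one: "cmod (E (\<lambda>_. 1) - 1 / of_nat q) \<le> B"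
proof -
  have "gaussK 0 = -1"
  proof -
    have "1 \<in> K" "0 \<in> K" using K by (auto simp: is_subfield_def)
    then have "(\<Sum>u\<in>K. \<psi> (- (1 * u * \<beta>))) = 0"
      using sum_add_character[OF K add_character_twist, of 1] by simp
    moreover have "(\<Sum>u\<in>K. \<psi> (- (1 * u * \<beta>))) = 1 + gaussK 0"
      using \<open>0 \<in> K\<close> psi_0 by (simp add: gaussK_def sum.remove)
    ultimately show ?thesis by (simp add: add_eq_0_iff)
  qed
  moreover have "gaussF 0 = -1"
  proof -
    have "(\<Sum>u\<in>UNIV. Psi (1 * u)) = 0"
      using sum_add_character[OF is_subfield_UNIV add_character_Psi Psi_nontriv, of 1] by simp
    moreover have "Psi 0 = 1" using q_ge_2 psi_0 by (simp add: Psi_def tr_def ff_trace_def zero_power)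
    then have "(\<Sum>u\<in>UNIV. Psi (1 * u)) = 1 + gaussF 0"
      by (simp add: gaussF_def sum.remove[of UNIV 0])
    ultimately show ?thesis by (simp add: add_eq_0_iff)
  qed
  moreover have "E (\<lambda>_. 1) = E (chi (2 * 0))" by (simp add: E_def)
  ultimately have "E (\<lambda>_. 1) - 1 / of_nat q = gaussK M * gaussF M / of_nat q"
    unfolding E_chi_even by simp
  then show ?thesis using norm_gauss_product_le[of M] by simp
qed

section \<open>Error terms of the sieve and the count\<close>

text \<open>Multiplying by \<open>avg p\<close> only shifts the index \<open>j\<close>, so one prime
  is removed from the sieve without leaving the family of sums.\<close>

lemma E_chi_sieve_insert:
  assumes "finite P" "p \<notin> P"
  shows "E (\<lambda>x. chi j x * sieve (insert p P) x) = E (\<lambda>x. chi j x * sieve P x) -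
     (\<Sum>i\<in>{1..<p}. E (\<lambda>x. chi (j + i * (N div p)) x * sieve P x)) / of_nat (p - 1)"
proof -
  have "(\<Sum>i\<in>{1..<p}. E (\<lambda>x. chi (j + i * (N div p)) x * sieve P x)) / of_nat (p - 1) =
      E (\<lambda>x. chi j x * avg p x * sieve P x)"
    unfolding E_def avg_def
    by (subst sum.swap)
      (simp add: chi_add sum_divide_distrib sum_distrib_left sum_distrib_right mult_ac)
  moreover have "E (\<lambda>x. chi j x * sieve (insert p P) x) =
      E (\<lambda>x. chi j x * sieve P x) - E (\<lambda>x. chi j x * avg p x * sieve P x)"
    using assms by (simp add: E_def sieve_def sum_subtractf[symmetric] algebra_simps)
  ultimately show ?thesis by simp
qed

text \<open>Each prime doubles the bound. The induction runs over all \<open>j\<close> at once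
  because removing a prime shifts the index.\<close>

lemma norm_E_chi_sieve_le:
  assumes "finite P" "\<forall>p\<in>P. prime p"
  shows "cmod (E (\<lambda>x. chi j x * sieve P x)) \<le> 2 ^ card P * (2 * B)"
  using assms
proof (induction P arbitrary: j rule: finite_induct)
  case empty
  then show ?case using norm_E_chi_le[of j] by (simp add: sieve_def)
next
  case (insert p P)
  have "p > 1" using insert.prems prime_gt_1_nat by simp
  then have "cmod ((\<Sum>i\<in>{1..<p}. E (\<lambda>x. chi (j + i * (N div p)) x * sieve P x)) / of_nat (p - 1))
      \<le> 2 ^ card P * (2 * B)"
    using insert by (intro norm_average_le) auto
  then have "cmod (E (\<lambda>x. chi j x * sieve (insert p P) x)) \<le> 2 ^ card P * (2 * B) + 2 ^ card P * (2 * B)"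
    unfolding E_chi_sieve_insert[OF insert.hyps]
    using insert by (intro order.trans[OF norm_triangle_ineq4] add_mono) auto
  then show ?case using insert.hyps by (simp add: mult_ac)
qed

text \<open>The trivial term is kept apart because \<open>norm_E_one\<close> treats it more sharply.
  Each new prime adds at most \<open>2 ^ card P\<close> sums of size \<open>2 * B\<close>, and these
  powers of 2 add up to \<open>2 ^ card P - 1\<close>.\<close>

lemma norm_E_sieve_diff_le:
  assumes "finite P" "\<forall>p\<in>P. prime p"
  shows "cmod (E (sieve P) - E (\<lambda>_. 1)) \<le> (2 ^ card P - 1) * (2 * B)"
  using assms
proof (induction P rule: finite_induct)
  case empty
  then show ?case by (simp add: sieve_def)
next
  case (insert p P)
  have "p > 1" using insert.prems prime_gt_1_nat by simp
  define A where "A = (\<Sum>i\<in>{1..<p}. E (\<lambda>x. chi (0 + i * (N div p)) x * sieve P x)) / of_nat (p - 1)"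
  have "cmod A \<le> 2 ^ card P * (2 * B)"
    unfolding A_def using \<open>p > 1\<close> insert by (intro norm_average_le norm_E_chi_sieve_le) auto
  moreover have eq: "E (sieve (insert p P)) - E (\<lambda>_. 1) = (E (sieve P) - E (\<lambda>_. 1)) - A"
    using E_chi_sieve_insert[OF insert.hyps, of 0] by (simp add: A_def)
  moreover have "cmod (E (sieve P) - E (\<lambda>_. 1)) \<le> (2 ^ card P - 1) * (2 * B)"
    using insert by simp
  ultimately have "cmod (E (sieve (insert p P)) - E (\<lambda>_. 1)) \<le>
      (2 ^ card P - 1) * (2 * B) + 2 ^ card P * (2 * B)"
    unfolding eq using norm_triangle_ineq4[of "E (sieve P) - E (\<lambda>_. 1)" A] by linarith
  then show ?case using insert.hyps by (simp add: algebra_simps)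
qed

lemma N_free_lower_bound:
  assumes m: "m dvd N"
  shows "theta m * B * (B - 2 * real (W m) + 1) \<le> real (N_free q n \<beta> m)"
proof -
  let ?P = "prime_factors m"
  have q0: "real q > 0" using q_ge_2 by simp
  have B2: "B * B = real (q ^ n) / real q"
  proof -
    have "B * B = real q powr (real n - 1)"
      unfolding B_def powr_add[symmetric] by simp
    then show ?thesis using q0 by (simp add: powr_diff powr_realpow)
  qed
  have "of_nat (N_free q n \<beta> m) = (\<Sum>x\<in>UNIV. of_bool (m_free m x \<and> tr (x\<^sup>2) = \<beta>) :: complex)"
    by (simp add: N_free_def tr_def sum_of_bool_eq Int_def)
  also have "\<dots> = (\<Sum>x\<in>UNIV-{0}. of_bool (m_free m x \<and> tr (x\<^sup>2) = \<beta>))"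
    by (rule sum.mono_neutral_right) (auto simp: m_free_def)
  \<comment> \<open>The trace indicator is replaced by its density plus its deviation: the density
    part counts the m-free elements.\<close>
  also have "\<dots> = (\<Sum>x\<in>UNIV-{0}. of_bool (m_free m x) * deviation x + of_bool (m_free m x) / of_nat q)"
    by (intro sum.cong) (auto simp: deviation_def)
  also have "\<dots> = E (\<lambda>x. of_bool (m_free m x)) + (\<Sum>x\<in>UNIV-{0::'a}. of_bool (m_free m x)) / of_nat q"
    by (simp only: E_def sum.distrib sum_divide_distrib)
  also have "E (\<lambda>x. of_bool (m_free m x)) = of_real (theta m) * E (sieve ?P)"
    by (simp add: E_def sum_distrib_left m_free_indicator[OF m] mult.assoc)
  also have "(\<Sum>x\<in>UNIV-{0::'a}. of_bool (m_free m x)) = (of_nat (card {x::'a. m_free m x}) :: complex)"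
  proof -
    have "{x::'a. m_free m x} = (UNIV - {0}) \<inter> {x. m_free m x}" by (auto simp: m_free_def)
    then show ?thesis by (simp add: sum_of_bool_eq)
  qed
  also have "(of_nat (card {x::'a. m_free m x}) :: complex) = of_real (theta m * real N)"
    using card_m_free[OF m] by (metis of_real_of_nat_eq)
  finally have eq: "of_nat (N_free q n \<beta> m) =
      of_real (theta m) * (E (sieve ?P) + of_real (real N / real q))"
    by (simp add: algebra_simps)
  \<comment> \<open>The error around the main term \<open>B * B = q ^ n / q\<close>. Since
    \<open>N = q ^ n - 1\<close>, the missing \<open>1 / q\<close> is the one subtracted in
    \<open>norm_E_one\<close>.\<close>
  define z where "z = E (sieve ?P) + of_real (real N / real q) - of_real (B * B)"
  have Nq: "real N = real (q ^ n) - 1" using N_eq card q_ge_2 by (simp add: of_nat_diff)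
  have "z = (E (sieve ?P) - E (\<lambda>_. 1)) + (E (\<lambda>_. 1) - 1 / of_nat q)"
    unfolding z_def B2 Nq by (simp add: diff_divide_distrib)
  moreover have "cmod (E (sieve ?P) - E (\<lambda>_. 1)) \<le> (2 ^ card ?P - 1) * (2 * B)"
    by (rule norm_E_sieve_diff_le) (auto simp: in_prime_factors_iff)
  \<comment> \<open>The right-hand side is \<open>B * (2 * W m - 1)\<close>.\<close>
  ultimately have "cmod z \<le> (2 ^ card ?P - 1) * (2 * B) + B"
    using norm_E_one norm_triangle_ineq[of "E (sieve ?P) - E (\<lambda>_. 1)" "E (\<lambda>_. 1) - 1 / of_nat q"]
    by simp
  then have "Re z \<ge> - (B * (2 * real (W m) - 1))"
    using abs_Re_le_cmod[of z] by (simp add: W_def algebra_simps)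
  moreover have "real (N_free q n \<beta> m) = theta m * (B * B + Re z)"
    using arg_cong[OF eq, of Re] by (simp add: z_def algebra_simps)
  moreover have "theta m \<ge> 0" by (simp add: theta_def)
  ultimately have "real (N_free q n \<beta> m) \<ge> theta m * (B * B - B * (2 * real (W m) - 1))"
    by (simp add: mult_left_mono)
  then show ?thesis by (simp add: algebra_simps)
qed

end

section \<open>The lower bound\<close>

text \<open>\<open>prime_part\<close> is a product of distinct primes, so its factorization can be
  read off.\<close>

lemma prime_factors_prime_part:
  "prime_factors (prime_part m Q) = {p \<in> prime_factors m. p dvd Q}"
proof -
  let ?S = "{p \<in> prime_factors m. p dvd Q}"
  have "prime_factorization (\<Prod>p\<in>?S. p) = (\<Sum>p\<in>?S. prime_factorization p)"
    by (rule prime_factorization_prod) (auto simp: in_prime_factors_iff)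
  also have "\<dots> = (\<Sum>p\<in>?S. {#p#})"
    by (intro sum.cong) (auto simp: in_prime_factors_iff prime_factorization_prime)
  also have "set_mset \<dots> = ?S"
    by (subst set_mset_sum) auto
  finally show ?thesis by (simp add: prime_part_def)
qed

lemma W_prime_part_le: "W (prime_part m Q) \<le> W m"
  unfolding W_def prime_factors_prime_part by (intro power_increasing card_mono) auto

lemma W_prime_part_eq:
  assumes "Q dvd m" "m > 0"
  shows "W (prime_part m Q) = W Q"
proof -
  have "{p \<in> prime_factors m. p dvd Q} = prime_factors Q"
    using assms by (auto simp: in_prime_factors_iff intro: dvd_trans)
  then show ?thesis by (simp add: W_def prime_factors_prime_part)
qed

theorem theorem5p2:
  fixes K :: "'a::{field,finite} set"
    and \<beta> :: 'a
    and q n m Q :: nat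
  assumes "primepow q" and "odd q"
    and "prime n"
    and "even ((q ^ n - 1) div 2)"
    and "CARD('a) = q ^ n"
    and "is_subfield K" and "card K = q"
    and "\<beta> \<in> K" and "\<beta> \<noteq> 0"
    and "even m" and "m dvd q ^ n - 1"
    and "Q = (q ^ n - 1) div (q - 1)"
  shows "real (N_free q n \<beta> m) \<ge>
           theta m * real q powr ((real n - 1) / 2) *
             (real q powr ((real n - 1) / 2) - 4 * real (W m) + 2 * real (W (prime_part m Q)) + 1)
         \<and> (real q powr ((real n - 1) / 2) > 4 * real (W (q ^ n - 1)) - 2 * real (W Q) - 1
             \<longrightarrow> N_free q n \<beta> (q ^ n - 1) > 0)"
proof -
  obtain r where r: "r > 0" "q = CHAR('a) ^ r"
    using primepow_card_root_eq_CHAR_power[OF assms(1,5)] by blast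
  have card_K: "card K = CHAR('a) ^ r" using assms(7) r by simp
  obtain \<psi> where \<psi>: "add_character K \<psi>" "\<exists>x\<in>K. \<psi> x \<noteq> 1"
    using nontrivial_add_character_exists[OF assms(6) card_K r(1)] by blast
  obtain g :: 'a where g: "g \<noteq> 0" "\<And>x. x \<noteq> 0 \<Longrightarrow> \<exists>k. x = g ^ k"
    using finite_field_generator_exists by blast
  \<comment> \<open>Oddness of \<open>q\<close> provides the index \<open>M\<close> of the quadratic
    character.\<close>
  have "even (q ^ n - 1)" using assms(2) by simp
  then obtain M where M: "q ^ n - 1 = 2 * M" by blast
  interpret trace_count g "q ^ n - 1" K q n r M \<psi> \<beta>
    by unfold_locales (use assms r g \<psi> M prime_gt_0_nat in auto)
  have bound: "real (N_free q n \<beta> m) \<ge>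
      theta m * B * (B - 4 * real (W m) + 2 * real (W (prime_part m Q)) + 1)"
    if "m dvd q ^ n - 1" for m
  proof -
    have "theta m * B \<ge> 0" by (simp add: theta_def B_def)
    moreover have "real (W (prime_part m Q)) \<le> real (W m)"
      using W_prime_part_le by simp
    ultimately have "theta m * B * (B - 4 * real (W m) + 2 * real (W (prime_part m Q)) + 1) \<le>
        theta m * B * (B - 2 * real (W m) + 1)"
      by (intro mult_left_mono) auto
    also note N_free_lower_bound[OF that]
    finally show ?thesis .
  qed
  moreover have "N_free q n \<beta> (q ^ n - 1) > 0"
    if large: "B > 4 * real (W (q ^ n - 1)) - 2 * real (W Q) - 1"
  proof -
    \<comment> \<open>The geometric sum factorization is taken over the integers, where subtraction
      is not truncated.\<close>
    have "int (q - 1) dvd int (q ^ n - 1)"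
      using power_diff_1_eq[of "int q" n] q_ge_2 by (simp add: of_nat_diff)
    then have "q - 1 dvd q ^ n - 1" by (simp only: int_dvd_int_iff)
    then have "Q dvd q ^ n - 1" by (metis assms(12) dvd_div_mult_self dvd_triv_left)
    then have "W (prime_part (q ^ n - 1) Q) = W Q"
      using N_pos by (rule W_prime_part_eq)
    with large have "B - 4 * real (W (q ^ n - 1)) + 2 * real (W (prime_part (q ^ n - 1) Q)) + 1 > 0"
      by simp
    moreover have "theta (q ^ n - 1) * B > 0"
      unfolding theta_def B_def using N_pos q_ge_2
      by (intro mult_pos_pos divide_pos_pos) (simp_all del: of_nat_diff)
    ultimately have "theta (q ^ n - 1) * B *
        (B - 4 * real (W (q ^ n - 1)) + 2 * real (W (prime_part (q ^ n - 1) Q)) + 1) > 0"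
      by (rule mult_pos_pos[rotated])
    with bound[of "q ^ n - 1"] show ?thesis by simp
  qed
  ultimately show ?thesis using assms(11) unfolding B_def by blast
qed

end
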